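(* Let $n\ge3$, $2^{n-3}<k\le 2^{n-2}$, and let $H$ be a spanned hyperplane of $Q_n$ containing at least $k$ points of $V_n$. For $w\in B_n$ put $q(w)=|V_n(H\cap w(H))|$. Then the number $N_H(k)$ of partial $0/1$-equivalence classes of $H$ with $k$ vertices satisfies $$N_H(k)=\left[u_1^ku_2^{|V_n(H)|-k}\right]C_H(u_1,u_2)-\sum_{H\cap w(H)\in E_1(H,k)}\left[u_1^ku_2^{q(w)-k}\right]C_{(H,w)}(u_1,u_2)+\sum_{H\cap w(H)\in E_2(H,k)}\left[u_1^ku_2^{q(w)-k}\right]C_{H\cap w(H)}(u_1,u_2).$$
   Context: $Q_n=[0,1]^n$, $V_n=\{0,1\}^n$. A $0/1$-polytope of $Q_n$ is the convex hull of a nonempty subset of $V_n$; it has $k$ vertices if the subset has $k$ elements. $B_n$ is the group of signed permutations $w$ of $\{1,\dots,n\}$ (underlying permutation $\pi$, sign $\pm$ on each $i$) acting on $\mathbb{R}^n$ by $w(x)_i=x_{\pi(i)}$ (sign $+$) or $1-x_{\pi(i)}$ (sign $-$), and on subsets by taking images. A spanned hyperplane of $Q_n$ is a hyperplane $H$ such that the affine hull of $H\cap V_n$ is $H$; for $S\subset\mathbb{R}^n$, $V_n(S)=S\cap V_n$. Partial $0/1$-equivalence classes of $H$: $0/1$-polytopes contained in $H$ under $P\sim P'$ iff $g(P)=P'$ for some $g\in B_n$. $F(H)=\{g\in B_n:g(H)=H\}$; $F(H,w)=\{g\in F(H):g(H\cap w(H))=H\cap w(H)\}$; $F(H\cap w(H))=\{g\in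 B_n:g(H\cap w(H))=H\cap w(H)\}$. $E(H,k)$ is the set of intersections $H\cap w(H)$ with $w\in B_n$, $w(H)\ne H$, containing at least $k$ points of $V_n$; $E_1(H,k)$ (resp. $E_2(H,k)$) is a set of representatives of the classes of $E(H,k)$ under the relation "some $g\in F(H)$ (resp. $g\in B_n$) maps one onto the other". For a finite group $G$ acting on a finite set $X$, the cycle index is $\frac{1}{|G|}\sum_{g\in G}\prod_i z_i^{c_i(g)}$ with $c_i(g)$ the number of $i$-cycles of $g$ on $X$. $C_H$, $C_{(H,w)}$, $C_{H\cap w(H)}$ are obtained by substituting $z_i\mapsto u_1^i+u_2^i$ into the cycle indices of $F(H)$ acting on $V_n(H)$, of $F(H,w)$ acting on $V_n(H\cap w(H))$, and of $F(H\cap w(H))$ acting on $V_n(H\cap w(H))$, respectively. $[u_1^pu_2^q]$ denotes the coefficient of $u_1^pu_2^q$. *)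

theory Defs
  imports
    "HOL-Analysis.Analysis"
    "HOL-Combinatorics.Orbits"
    "HOL-Library.Poly_Mapping"
    "HOL-Computational_Algebra.Polynomial"
begin

text \<open>The dimension \<open>n\<close> is \<open>CARD('n)\<close>, and coordinates are indexed by \<open>'n\<close>.\<close>

definition cube_vertices :: "(real ^ 'n) set" where
  "cube_vertices = {x. \<forall>i. x $ i \<in> {0, 1}}"

definition vertices_in :: "(real ^ 'n) set \<Rightarrow> (real ^ 'n) set" where
  "vertices_in S = S \<inter> cube_vertices"

text \<open>A signed permutation is a pair \<open>(\<pi>, \<epsilon>)\<close>, where \<open>\<epsilon> i\<close> holds iff the sign on \<open>i\<close> is \<open>+\<close>.\<close>

type_synonym 'n signed_perm = "('n \<Rightarrow> 'n) \<times> ('n \<Rightarrow> bool)"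

definition signed_perms :: "('n::finite) signed_perm set" where
  "signed_perms = {(\<pi>, \<epsilon>). bij \<pi>}"

definition act :: "('n::finite) signed_perm \<Rightarrow> real ^ 'n \<Rightarrow> real ^ 'n" where
  "act w x = (\<chi> i. if snd w i then x $ fst w i else 1 - x $ fst w i)"

text \<open>The maps \<open>act w\<close> form a group isomorphic to the hyperoctahedral group: the identity,
  composites and inverses are again of this form, and the action is faithful.\<close>

lemma act_id: "(id, \<lambda>_. True) \<in> signed_perms" "act (id, \<lambda>_. True) = id"
  by (auto simp: signed_perms_def act_def fun_eq_iff vec_eq_iff)

lemma act_comp:
  assumes "v \<in> signed_perms" "w \<in> signed_perms"
  shows "\<exists>u\<in>signed_perms. act u = act v \<circ> act w"
proof
  let ?u = "(fst w \<circ> fst v, \<lambda>i. snd v i = snd w (fst v i))"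
  show "?u \<in> signed_perms"
    using assms by (auto simp: signed_perms_def bij_comp)
  show "act ?u = act v \<circ> act w"
    by (auto simp: act_def fun_eq_iff vec_eq_iff)
qed

lemma act_inverse:
  assumes "w \<in> signed_perms"
  shows "\<exists>u\<in>signed_perms. act u \<circ> act w = id \<and> act w \<circ> act u = id"
proof
  let ?u = "(inv (fst w), \<lambda>i. snd w (inv (fst w) i))"
  have b: "bij (fst w)"
    using assms by (auto simp: signed_perms_def)
  then show "?u \<in> signed_perms"
    by (auto simp: signed_perms_def bij_imp_bij_inv)
  show "act ?u \<circ> act w = id \<and> act w \<circ> act ?u = id"
    using b by (auto simp: act_def fun_eq_iff vec_eq_iff bij_inv_eq_iff
        bij_is_inj bij_is_surj surj_f_inv_f inv_f_f)
qed

lemma act_faithful: "inj (act :: ('n::finite) signed_perm \<Rightarrow> _)"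
proof (rule injI)
  fix v w :: "'n signed_perm"
  assume eq: "act v = act w"
  have sgn: "snd v = snd w"
  proof
    fix i
    from eq have "act v 0 $ i = act w 0 $ i" by simp
    then show "snd v i = snd w i" by (simp add: act_def split: if_splits)
  qed
  have "fst v = fst w"
  proof
    fix i
    from eq have "act v (axis (fst v i) 1) $ i = act w (axis (fst v i) 1) $ i" by simp
    then show "fst v i = fst w i" using sgn by (simp add: act_def axis_def split: if_splits)
  qed
  with sgn show "v = w" by (simp add: prod_eq_iff)
qed

definition hyperplane :: "(real ^ 'n) set \<Rightarrow> bool" where
  "hyperplane H \<longleftrightarrow> (\<exists>a b. a \<noteq> 0 \<and> H = {x. a \<bullet> x = b})"

definition spanned_hyperplane :: "(real ^ 'n) set \<Rightarrow> bool" where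
  "spanned_hyperplane H \<longleftrightarrow> hyperplane H \<and> affine hull (vertices_in H) = H"

definition polytope01 :: "(real ^ 'n) set \<Rightarrow> bool" where
  "polytope01 P \<longleftrightarrow> (\<exists>S. S \<noteq> {} \<and> S \<subseteq> cube_vertices \<and> P = convex hull S)"

definition polytope01_card :: "nat \<Rightarrow> (real ^ 'n) set \<Rightarrow> bool" where
  "polytope01_card k P \<longleftrightarrow>
     (\<exists>S. S \<noteq> {} \<and> S \<subseteq> cube_vertices \<and> card S = k \<and> P = convex hull S)"

definition polytopes01_in :: "(real ^ 'n) set \<Rightarrow> (real ^ 'n) set set" where
  "polytopes01_in H = {P. polytope01 P \<and> P \<subseteq> H}"

definition partial_equiv :: "(real ^ 'n) set \<Rightarrow> ((real ^ 'n) set \<times> (real ^ 'n) set) set" where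
  "partial_equiv H = {(P, P'). P \<in> polytopes01_in H \<and> P' \<in> polytopes01_in H \<and>
     (\<exists>g\<in>signed_perms. act g ` P = P')}"

definition partial_classes :: "(real ^ 'n) set \<Rightarrow> nat \<Rightarrow> (real ^ 'n) set set set" where
  "partial_classes H k = {C \<in> polytopes01_in H // partial_equiv H. \<exists>P\<in>C. polytope01_card k P}"

lemma equiv_partial_equiv:
  fixes H :: "(real ^ 'a::finite) set"
  shows "equiv (polytopes01_in H) (partial_equiv H)"
proof (rule equivI)
  show "partial_equiv H \<subseteq> polytopes01_in H \<times> polytopes01_in H"
    by (auto simp: partial_equiv_def)
  show "refl_on (polytopes01_in H) (partial_equiv H)"
  proof (rule refl_onI)
    fix P :: "(real ^ 'a) set"
    assume "P \<in> polytopes01_in H"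
    moreover have "act (id, \<lambda>_. True) ` P = P"
      by (simp add: act_id)
    ultimately show "(P, P) \<in> partial_equiv H"
      using act_id(1) by (auto simp: partial_equiv_def)
  qed
  show "sym (partial_equiv H)"
  proof (rule symI)
    fix P P'
    assume PP': "(P, P') \<in> partial_equiv H"
    then obtain g where g: "g \<in> signed_perms" "act g ` P = P'"
      by (auto simp: partial_equiv_def)
    obtain u where u: "u \<in> signed_perms" "act u \<circ> act g = id"
      using act_inverse[OF g(1)] by blast
    have "act u ` P' = P"
      using g(2) u(2) by (metis image_comp image_id id_apply)
    with PP' u(1) show "(P', P) \<in> partial_equiv H"
      by (auto simp: partial_equiv_def)
  qed
  show "trans (partial_equiv H)"
  proof (rule transI)
    fix P P' P''
    assume a: "(P, P') \<in> partial_equiv H" "(P', P'') \<in> partial_equiv H"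
    then obtain g h where gh: "g \<in> signed_perms" "act g ` P = P'"
        "h \<in> signed_perms" "act h ` P' = P''"
      by (auto simp: partial_equiv_def)
    obtain u where u: "u \<in> signed_perms" "act u = act h \<circ> act g"
      using act_comp[OF gh(3) gh(1)] by blast
    have "act u ` P = P''"
      using gh u(2) by (metis image_comp)
    with a u(1) show "(P, P'') \<in> partial_equiv H"
      by (auto simp: partial_equiv_def)
  qed
qed

text \<open>\<open>stab H\<close> is \<open>F(H)\<close> and \<open>stab (H \<inter> w(H))\<close> is \<open>F(H \<inter> w(H))\<close>. The group \<open>F(H,w)\<close> depends
  on \<open>w\<close> only through \<open>X = H \<inter> w(H)\<close>, and is written \<open>stab2 H X\<close>.\<close>

definition stab :: "(real ^ 'n) set \<Rightarrow> ('n::finite) signed_perm set" where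
  "stab S = {g \<in> signed_perms. act g ` S = S}"

definition stab2 :: "(real ^ 'n) set \<Rightarrow> (real ^ 'n) set \<Rightarrow> ('n::finite) signed_perm set" where
  "stab2 H X = {g \<in> stab H. act g ` X = X}"

definition intersections :: "(real ^ 'n) set \<Rightarrow> nat \<Rightarrow> (real ^ 'n) set set" where
  "intersections H k = {H \<inter> act w ` H | w. w \<in> signed_perms \<and> act w ` H \<noteq> H \<and>
     card (vertices_in (H \<inter> act w ` H)) \<ge> k}"

definition representatives ::
    "('n::finite) signed_perm set \<Rightarrow> (real ^ 'n) set set \<Rightarrow> (real ^ 'n) set set \<Rightarrow> bool" where
  "representatives G \<E> R \<longleftrightarrow> R \<subseteq> \<E> \<and> (\<forall>X\<in>\<E>. \<exists>!Y. Y \<in> R \<and> (\<exists>g\<in>G. act g ` X = Y))"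

text \<open>Polynomials over the rationals in the indeterminates \<open>z\<^sub>0, z\<^sub>1, \<dots>\<close> are finitely supported
  maps from exponent vectors to coefficients.\<close>

type_synonym zpoly = "(nat \<Rightarrow>\<^sub>0 nat) \<Rightarrow>\<^sub>0 rat"

definition zvar :: "nat \<Rightarrow> zpoly" where
  "zvar i = Poly_Mapping.single (Poly_Mapping.single i 1) 1"

definition cycle_count :: "('a \<Rightarrow> 'a) \<Rightarrow> 'a set \<Rightarrow> nat \<Rightarrow> nat" where
  "cycle_count f X i = card {C \<in> orbit f ` X. card C = i}"

definition cycle_index :: "'g set \<Rightarrow> ('g \<Rightarrow> 'a \<Rightarrow> 'a) \<Rightarrow> 'a set \<Rightarrow> zpoly" where
  "cycle_index G \<phi> X =
     Poly_Mapping.single 0 (1 / of_nat (card G)) *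
       (\<Sum>g\<in>G. \<Prod>i\<in>{1..card X}. zvar i ^ cycle_count (\<phi> g) X i)"

text \<open>Polynomials in \<open>u\<^sub>1, u\<^sub>2\<close> have type \<open>rat poly poly\<close>, with inner indeterminate \<open>u\<^sub>1\<close> and
  outer indeterminate \<open>u\<^sub>2\<close>.\<close>

definition u1 :: "rat poly poly" where "u1 = [:[:0, 1:]:]"
definition u2 :: "rat poly poly" where "u2 = [:0, 1:]"

definition coeff_u :: "nat \<Rightarrow> nat \<Rightarrow> rat poly poly \<Rightarrow> rat" where
  "coeff_u p q F = coeff (coeff F q) p"

definition subst :: "(nat \<Rightarrow> rat poly poly) \<Rightarrow> zpoly \<Rightarrow> rat poly poly" where
  "subst f P = (\<Sum>m\<in>Poly_Mapping.keys P.
     [:[:Poly_Mapping.lookup P m:]:] *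
       (\<Prod>i\<in>Poly_Mapping.keys m. f i ^ Poly_Mapping.lookup m i))"

definition two_colour :: "zpoly \<Rightarrow> rat poly poly" where
  "two_colour = subst (\<lambda>i. u1 ^ i + u2 ^ i)"

definition C_hyp :: "(real ^ 'n::finite) set \<Rightarrow> rat poly poly" where
  "C_hyp H = two_colour (cycle_index (stab H) act (vertices_in H))"

definition C_pair :: "(real ^ 'n::finite) set \<Rightarrow> (real ^ 'n) set \<Rightarrow> rat poly poly" where
  "C_pair H X = two_colour (cycle_index (stab2 H X) act (vertices_in X))"

definition C_inter :: "(real ^ 'n::finite) set \<Rightarrow> rat poly poly" where
  "C_inter X = two_colour (cycle_index (stab X) act (vertices_in X))"

end

theory Submission
  imports Defs
begin

text \<open>A \<open>0/1\<close>-polytope is determined by its vertex set, so \<open>N\<^sub>H(k)\<close> counts the \<open>k\<close>-subsets of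
  \<open>V\<^sub>n(H)\<close> up to \<open>B\<^sub>n\<close>, while the first coefficient counts them up to \<open>F(H)\<close> by Burnside's lemma.
  If \<open>g S \<subseteq> H\<close> for some \<open>S \<subseteq> H\<close> and \<open>g(H) \<noteq> H\<close>, then \<open>g S\<close> lies in \<open>H \<inter> g(H) \<in> E(H,k)\<close>; hence
  the two equivalences agree on the subsets contained in no member of \<open>E(H,k)\<close>, and the two sums
  correct the count on the other ones. A flat of dimension \<open>d\<close> contains at most \<open>2\<^sup>d\<close> vertices of
  the cube, so \<open>k > 2\<^bsup>n-3\<^esup>\<close> forces a \<open>k\<close>-subset of a member \<open>X\<close> of \<open>E(H,k)\<close> to span \<open>X\<close>. Thus \<open>X\<close> is
  unique, and classes of these subsets can be counted inside representatives \<open>X\<close>, up to the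
  stabilizer of \<open>X\<close>.\<close>

section \<open>Counting classes\<close>

text \<open>A class \<open>C\<close> collects \<open>card C\<close> summands equal to
  \<open>1 / card C\<close>, hence contributes 1. Counting classes thus becomes a sum over elements,
  which can be split along subsets of \<open>A\<close>. The values are rational so that the weights
  make sense.\<close>

lemma card_quotient_eq_sum:
  assumes "finite A" "equiv A r"
  shows "of_nat (card (A // r)) = (\<Sum>x\<in>A. 1 / of_nat (card (r `` {x})) :: rat)"
proof -
  have "(\<Sum>x\<in>A. 1 / of_nat (card (r `` {x})) :: rat)
      = (\<Sum>x\<in>\<Union>(A // r). 1 / of_nat (card (r `` {x})))"
    using assms by (simp add: Union_quotient)
  also have "\<dots> = (\<Sum>C\<in>A // r. \<Sum>x\<in>C. 1 / of_nat (card (r `` {x})))"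
    by (subst sum.Union_disjoint)
      (use assms quotient_disj[OF assms(2)] finite_equiv_class in \<open>auto simp: equiv_def\<close>)
  also have "\<dots> = (\<Sum>C\<in>A // r. 1)"
  proof (rule sum.cong[OF refl])
    fix C assume C: "C \<in> A // r"
    have "r `` {x} = C" if "x \<in> C" for x
      using C assms(2) that by (metis Image_singleton_iff equiv_class_eq quotientE)
    moreover have "finite C"
      using C assms finite_equiv_class by (auto simp: equiv_def)
    moreover have "C \<noteq> {}"
      using C assms(2) in_quotient_imp_non_empty by blast
    ultimately show "(\<Sum>x\<in>C. 1 / of_nat (card (r `` {x})) :: rat) = 1"
      by simp
  qed
  finally show ?thesis by simp
qed

lemma equiv_restrict:
  assumes "equiv A r" "B \<subseteq> A"
  shows "equiv B (r \<inter> B \<times> B)"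
  using assms unfolding equiv_def refl_on_def sym_def trans_def by blast

text \<open>By saturation no class meets both \<open>B\<close> and \<open>A - B\<close>, so
  restricting \<open>r\<close> to either part leaves the class of each element unchanged. The
  weighted sum over \<open>A\<close> then splits.\<close>

lemma card_quotient_split:
  assumes "finite A" "equiv A r" "B \<subseteq> A" and sat: "r `` B \<subseteq> B"
  shows "card (A // r)
    = card (B // (r \<inter> B \<times> B)) + card ((A - B) // (r \<inter> (A - B) \<times> (A - B)))"
proof -
  let ?rB = "r \<inter> B \<times> B" and ?rC = "r \<inter> (A - B) \<times> (A - B)"
  have symr: "sym r" and rA: "r \<subseteq> A \<times> A"
    using assms(2) by (auto simp: equiv_def)
  have B: "r `` {x} = ?rB `` {x}" if "x \<in> B" for x
    using sat that by auto
  have C: "r `` {x} = ?rC `` {x}" if "x \<in> A - B" for x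
    using sat that symr rA by (auto dest: symD)
  have finB: "finite B" using assms finite_subset by blast
  have "(of_nat (card (A // r)) :: rat)
      = (\<Sum>x\<in>A - B. 1 / of_nat (card (r `` {x}))) + (\<Sum>x\<in>B. 1 / of_nat (card (r `` {x})))"
    using assms by (simp add: card_quotient_eq_sum sum.subset_diff)
  also have "(\<Sum>x\<in>A - B. 1 / of_nat (card (r `` {x})) :: rat) = of_nat (card ((A - B) // ?rC))"
    using assms by (subst card_quotient_eq_sum) (auto simp: C equiv_restrict intro!: sum.cong)
  also have "(\<Sum>x\<in>B. 1 / of_nat (card (r `` {x})) :: rat) = of_nat (card (B // ?rB))"
    using assms finB
    by (subst card_quotient_eq_sum) (auto simp: B[symmetric] equiv_restrict intro!: sum.cong)
  finally have "(of_nat (card (A // r)) :: rat)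
      = of_nat (card (B // ?rB) + card ((A - B) // ?rC))"
    by simp
  then show ?thesis by (simp only: of_nat_eq_iff)
qed

text \<open>The map \<open>p\<close> need not be constant on classes: a class may meet many fibres
  of \<open>p\<close>, but \<open>uniq\<close> says that exactly one of them lies over an index in
  \<open>R\<close>. This assigns every class to one index, and cutting the class down to that fibre
  loses nothing.\<close>

lemma card_quotient_fibres:
  assumes "finite A" "equiv A r" "finite R"
    and uniq: "\<And>x. x \<in> A \<Longrightarrow> \<exists>!X. X \<in> R \<and> (\<exists>y. (x, y) \<in> r \<and> p y = X)"
  shows "card (A // r)
    = (\<Sum>X\<in>R. card ({x \<in> A. p x = X} // (r \<inter> {x \<in> A. p x = X} \<times> {x \<in> A. p x = X})))"
proof -
  \<comment> \<open>\<open>\<C> X\<close> consists of the full classes that meet the fibre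
    \<open>F X\<close>. These families partition the quotient as \<open>X\<close> runs through
    \<open>R\<close>.\<close>
  define F where "F X = {x \<in> A. p x = X}" for X
  define \<C> where "\<C> X = (\<lambda>x. r `` {x}) ` F X" for X
  have rr: "(x, x) \<in> r" if "x \<in> A" for x
    using assms(2) that by (auto simp: equiv_def refl_on_def)
  have cls: "(x, y) \<in> r \<Longrightarrow> r `` {x} = r `` {y}" for x y
    using assms(2) by (rule equiv_class_eq)
  have rA': "(x, y) \<in> r \<Longrightarrow> x \<in> A \<and> y \<in> A" for x y
    using assms(2) by (auto simp: equiv_def)
  have "A // r = (\<Union>X\<in>R. \<C> X)"
  proof (intro equalityI subsetI)
    fix C assume "C \<in> A // r"
    then obtain x where x: "x \<in> A" "C = r `` {x}" by (auto elim: quotientE)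
    then obtain y where y: "p y \<in> R" "(x, y) \<in> r" using uniq by metis
    with x cls rA' show "C \<in> (\<Union>X\<in>R. \<C> X)" by (fastforce simp: \<C>_def F_def)
  qed (auto simp: \<C>_def F_def quotientI)
  also have "card \<dots> = (\<Sum>X\<in>R. card (\<C> X))"
  proof (rule card_UN_disjoint)
    show "\<forall>X\<in>R. finite (\<C> X)" using assms(1) by (auto simp: \<C>_def F_def)
    show "\<forall>X\<in>R. \<forall>Y\<in>R. X \<noteq> Y \<longrightarrow> \<C> X \<inter> \<C> Y = {}"
    proof (intro ballI impI equals0I)
      fix X Y C assume "X \<in> R" "Y \<in> R" "X \<noteq> Y" "C \<in> \<C> X \<inter> \<C> Y"
      then obtain x y where "x \<in> A" "y \<in> A" "p x = X" "p y = Y" "r `` {x} = r `` {y}"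
        by (auto simp: \<C>_def F_def)
      moreover have "(x, x) \<in> r" "(x, y) \<in> r" using calculation rr by blast+
      ultimately show False using uniq[of x] \<open>X \<in> R\<close> \<open>Y \<in> R\<close> \<open>X \<noteq> Y\<close> by blast
    qed
  qed fact
  also have "\<dots> = (\<Sum>X\<in>R. card (F X // (r \<inter> F X \<times> F X)))"
  proof (rule sum.cong[OF refl])
    fix X assume "X \<in> R"
    \<comment> \<open>Cutting a class down to \<open>F X\<close> is injective on the classes that
      meet \<open>F X\<close>: a common element of two classes makes them equal.\<close>
    have "F X // (r \<inter> F X \<times> F X) = (\<lambda>C. C \<inter> F X) ` \<C> X"
      unfolding quotient_def \<C>_def by auto
    moreover have "inj_on (\<lambda>C. C \<inter> F X) (\<C> X)"
    proof (rule inj_onI)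
      fix C D assume CD: "C \<in> \<C> X" "D \<in> \<C> X" "C \<inter> F X = D \<inter> F X"
      then obtain x y where xy: "x \<in> F X" "y \<in> F X" "C = r `` {x}" "D = r `` {y}"
        by (auto simp: \<C>_def)
      then have "(y, x) \<in> r" using CD(3) rr[of x] by (auto simp: F_def)
      then show "C = D" using xy cls by simp
    qed
    ultimately show "card (\<C> X) = card (F X // (r \<inter> F X \<times> F X))"
      by (simp add: card_image)
  qed
  finally show ?thesis by (simp add: F_def)
qed

section \<open>Orbit counting for finite groups of bijections, up to Burnside's lemma\<close>

definition image_rel :: "'g set \<Rightarrow> ('g \<Rightarrow> 'a \<Rightarrow> 'a) \<Rightarrow> 'a set set \<Rightarrow> ('a set \<times> 'a set) set" where
  "image_rel G \<phi> \<Y> = {(S, T). S \<in> \<Y> \<and> T \<in> \<Y> \<and> (\<exists>g\<in>G. \<phi> g ` S = T)}"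

lemma image_rel_restrict: "\<Z> \<subseteq> \<Y> \<Longrightarrow> image_rel G \<phi> \<Y> \<inter> \<Z> \<times> \<Z> = image_rel G \<phi> \<Z>"
  by (auto simp: image_rel_def)

text \<open>\<open>G\<close> is a set of labels without a product; the group laws hold for the maps
  \<open>\<phi> g\<close>. Faithfulness lets labels be counted through their maps, as signed
  permutations require.\<close>

locale faithful_action =
  fixes G :: "'g set" and \<phi> :: "'g \<Rightarrow> 'a \<Rightarrow> 'a"
  assumes finite_group: "finite G"
    and faithful: "inj_on \<phi> G"
    and one: "\<exists>e\<in>G. \<phi> e = id"
    and comp: "v \<in> G \<Longrightarrow> w \<in> G \<Longrightarrow> \<exists>u\<in>G. \<phi> u = \<phi> v \<circ> \<phi> w"
    and inverse: "w \<in> G \<Longrightarrow> \<exists>u\<in>G. \<phi> u \<circ> \<phi> w = id \<and> \<phi> w \<circ> \<phi> u = id"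
begin

lemma bij_action: "g \<in> G \<Longrightarrow> bij (\<phi> g)"
  using inverse[of g] o_bij by blast

lemma group_nonempty: "card G \<noteq> 0"
  using one finite_group by auto

lemma equiv_image_rel: "equiv \<Y> (image_rel G \<phi> \<Y>)"
proof (rule equivI)
  show "image_rel G \<phi> \<Y> \<subseteq> \<Y> \<times> \<Y>" by (auto simp: image_rel_def)
  show "refl_on \<Y> (image_rel G \<phi> \<Y>)"
  proof (rule refl_onI)
    fix S assume "S \<in> \<Y>"
    moreover obtain e where "e \<in> G" "\<phi> e ` S = S" using one by (metis image_id id_apply)
    ultimately show "(S, S) \<in> image_rel G \<phi> \<Y>" by (auto simp: image_rel_def)
  qed
  show "sym (image_rel G \<phi> \<Y>)"
  proof (rule symI)
    fix S T assume "(S, T) \<in> image_rel G \<phi> \<Y>"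
    then obtain g where g: "S \<in> \<Y>" "T \<in> \<Y>" "g \<in> G" "\<phi> g ` S = T" by (auto simp: image_rel_def)
    then obtain u where "u \<in> G" "\<phi> u \<circ> \<phi> g = id" using inverse by blast
    then have "\<phi> u ` T = S" using g(4) by (metis image_comp image_id id_apply)
    then show "(T, S) \<in> image_rel G \<phi> \<Y>" using g \<open>u \<in> G\<close> by (auto simp: image_rel_def)
  qed
  show "trans (image_rel G \<phi> \<Y>)"
  proof (rule transI)
    fix S T U assume "(S, T) \<in> image_rel G \<phi> \<Y>" "(T, U) \<in> image_rel G \<phi> \<Y>"
    then obtain g h where g: "S \<in> \<Y>" "U \<in> \<Y>" "g \<in> G" "h \<in> G" "\<phi> h ` \<phi> g ` S = U"
      by (auto simp: image_rel_def)
    then obtain u where "u \<in> G" "\<phi> u = \<phi> h \<circ> \<phi> g" using comp by blast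
    then have "\<exists>u\<in>G. \<phi> u ` S = U" using g(5) by (metis image_comp)
    then show "(S, U) \<in> image_rel G \<phi> \<Y>" using g(1,2) by (simp add: image_rel_def)
  qed
qed

lemma stabilizer: "faithful_action {g \<in> G. \<phi> g ` X = X} \<phi>"
proof
  show "finite {g \<in> G. \<phi> g ` X = X}" using finite_group by simp
  show "inj_on \<phi> {g \<in> G. \<phi> g ` X = X}" using faithful by (rule inj_on_subset) auto
  show "\<exists>e\<in>{g \<in> G. \<phi> g ` X = X}. \<phi> e = id" using one by fastforce
next
  fix v w assume vw: "v \<in> {g \<in> G. \<phi> g ` X = X}" "w \<in> {g \<in> G. \<phi> g ` X = X}"
  then obtain u where u: "u \<in> G" "\<phi> u = \<phi> v \<circ> \<phi> w" using comp[of v w] by auto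
  have "\<phi> u ` X = X" using vw unfolding u(2) image_comp[symmetric] by simp
  then have "u \<in> {g \<in> G. \<phi> g ` X = X}" using u(1) by simp
  with u(2) show "\<exists>u\<in>{g \<in> G. \<phi> g ` X = X}. \<phi> u = \<phi> v \<circ> \<phi> w" by (rule bexI)
next
  fix w assume w: "w \<in> {g \<in> G. \<phi> g ` X = X}"
  then obtain u where u: "u \<in> G" "\<phi> u \<circ> \<phi> w = id" "\<phi> w \<circ> \<phi> u = id"
    using inverse[of w] by auto
  have "\<phi> u ` X = \<phi> u ` \<phi> w ` X" using w by simp
  also have "\<dots> = X" using u(2) by (simp add: image_comp)
  finally have "u \<in> {g \<in> G. \<phi> g ` X = X}" using u(1) by simp
  with u(2,3) show "\<exists>u\<in>{g \<in> G. \<phi> g ` X = X}. \<phi> u \<circ> \<phi> w = id \<and> \<phi> w \<circ> \<phi> u = id"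
    by (intro bexI conjI)
qed

text \<open>The labels in \<open>G\<close> are sorted by the image \<open>T\<close> of
  \<open>S\<close>. The blocks \<open>M T\<close> are the cosets of the stabilizer
  \<open>M S\<close>, so they all have its size, and there is one block for each \<open>T\<close> in
  the orbit.\<close>

lemma orbit_stabilizer:
  assumes "finite \<Y>" and closed: "\<And>g S. g \<in> G \<Longrightarrow> S \<in> \<Y> \<Longrightarrow> \<phi> g ` S \<in> \<Y>" and "S \<in> \<Y>"
  shows "card (image_rel G \<phi> \<Y> `` {S}) * card {g \<in> G. \<phi> g ` S = S} = card G"
proof -
  define M where "M T = {g \<in> G. \<phi> g ` S = T}" for T
  have "card (M T) = card (M S)" if T: "T \<in> image_rel G \<phi> \<Y> `` {S}" for T
  proof -
    obtain h where h: "h \<in> G" "\<phi> h ` S = T" using T by (auto simp: image_rel_def)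
    obtain h' where h': "h' \<in> G" "\<phi> h' \<circ> \<phi> h = id" "\<phi> h \<circ> \<phi> h' = id"
      using inverse[OF h(1)] by blast
    \<comment> \<open>The coset bijection is composition with \<open>\<phi> h\<close>. It is carried
      out on maps, and faithfulness brings the cardinalities back to labels.\<close>
    have "\<phi> ` M T = (\<lambda>f. \<phi> h \<circ> f) ` \<phi> ` M S"
    proof (intro equalityI subsetI)
      fix f assume "f \<in> \<phi> ` M T"
      then obtain g where g: "g \<in> G" "\<phi> g ` S = T" "f = \<phi> g" by (auto simp: M_def)
      obtain u where u: "u \<in> G" "\<phi> u = \<phi> h' \<circ> \<phi> g" using comp[OF h'(1) g(1)] by blast
      have "\<phi> u ` S = S" using u(2) g(2) h(2) h'(2) by (metis image_comp image_id id_apply)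
      moreover have "f = \<phi> h \<circ> \<phi> u" using u(2) h'(3) g(3) by (simp add: o_assoc)
      ultimately show "f \<in> (\<lambda>f. \<phi> h \<circ> f) ` \<phi> ` M S" using u(1) by (auto simp: M_def)
    next
      fix f assume "f \<in> (\<lambda>f. \<phi> h \<circ> f) ` \<phi> ` M S"
      then obtain g where g: "g \<in> G" "\<phi> g ` S = S" "f = \<phi> h \<circ> \<phi> g" by (auto simp: M_def)
      obtain u where u: "u \<in> G" "\<phi> u = \<phi> h \<circ> \<phi> g" using comp[OF h(1) g(1)] by blast
      have "\<phi> u ` S = T" using u(2) g(2) h(2) by (metis image_comp)
      then have "u \<in> M T" using u(1) by (simp add: M_def)
      then show "f \<in> \<phi> ` M T" using u(2) g(3) by (simp add: image_iff) metis
    qed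
    moreover have "inj_on (\<lambda>f. \<phi> h \<circ> f) (\<phi> ` M S)"
      using h'(2) by (intro inj_on_inverseI[where g = "\<lambda>f. \<phi> h' \<circ> f"]) (simp add: o_assoc)
    moreover have "card (\<phi> ` M T) = card (M T)" "card (\<phi> ` M S) = card (M S)"
      by (auto intro!: card_image inj_on_subset[OF faithful] simp: M_def)
    ultimately show ?thesis by (simp add: card_image)
  qed
  moreover have "G = (\<Union>T\<in>image_rel G \<phi> \<Y> `` {S}. M T)"
    using closed assms(3) by (auto simp: image_rel_def M_def)
  moreover have "card (\<Union>T\<in>image_rel G \<phi> \<Y> `` {S}. M T)
      = (\<Sum>T\<in>image_rel G \<phi> \<Y> `` {S}. card (M T))"
    using finite_group assms(1)
    by (intro card_UN_disjoint) (auto simp: M_def image_rel_def intro: finite_subset[of _ \<Y>])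
  ultimately show ?thesis by (simp add: M_def)
qed

text \<open>Orbit-stabilizer turns the weight of \<open>S\<close> from one over its orbit size into
  the stabilizer size over \<open>card G\<close>. Counting the pairs with \<open>\<phi> g\<close>
  fixing \<open>S\<close> in the other order gives the fixed-point average.\<close>

lemma burnside:
  assumes "finite \<Y>" and closed: "\<And>g S. g \<in> G \<Longrightarrow> S \<in> \<Y> \<Longrightarrow> \<phi> g ` S \<in> \<Y>"
  shows "of_nat (card (\<Y> // image_rel G \<phi> \<Y>))
    = (1 / of_nat (card G) * (\<Sum>g\<in>G. of_nat (card {S \<in> \<Y>. \<phi> g ` S = S})) :: rat)"
proof -
  have "1 / of_nat (card (image_rel G \<phi> \<Y> `` {S}))
      = (1 / of_nat (card G) * of_nat (card {g \<in> G. \<phi> g ` S = S}) :: rat)" if "S \<in> \<Y>" for S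
  proof -
    have "(of_nat (card G) :: rat)
        = of_nat (card (image_rel G \<phi> \<Y> `` {S})) * of_nat (card {g \<in> G. \<phi> g ` S = S})"
      using orbit_stabilizer[OF assms that] by (simp flip: of_nat_mult)
    moreover have "(of_nat (card G) :: rat) \<noteq> 0" using group_nonempty by simp
    ultimately show ?thesis by (auto simp: field_simps)
  qed
  then have "(of_nat (card (\<Y> // image_rel G \<phi> \<Y>)) :: rat)
      = 1 / of_nat (card G) * of_nat (\<Sum>S\<in>\<Y>. card {g \<in> G. \<phi> g ` S = S})"
    using assms(1) by (simp add: card_quotient_eq_sum equiv_image_rel sum_distrib_left)
  also have "(\<Sum>S\<in>\<Y>. card {g \<in> G. \<phi> g ` S = S}) = (\<Sum>g\<in>G. card {S \<in> \<Y>. \<phi> g ` S = S})"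
    using sum_multicount_gen[OF assms(1) finite_group, of "\<lambda>S g. \<phi> g ` S = S"] by simp
  finally show ?thesis by simp
qed

end

section \<open>The two-colour cycle index\<close>

text \<open>\<open>orbit f x\<close> starts at \<open>f x\<close>, so it contains \<open>x\<close>
  only because iteration returns. Replacing \<open>f\<close> by the identity outside
  \<open>V\<close> gives a permutation with the same orbits on \<open>V\<close>, to which the theory
  of permutations applies.\<close>

lemma orbits_bij_betw:
  assumes "finite V" "bij_betw f V V" "x \<in> V"
  shows "x \<in> orbit f x" "orbit f x \<subseteq> V" "\<And>y. y \<in> orbit f x \<Longrightarrow> orbit f y = orbit f x"
proof -
  let ?p = "perm_restrict f V"
  have p: "?p permutes V"
  proof (rule bij_imp_permutes)
    show "bij_betw ?p V V"
      using assms(2) by (subst bij_betw_cong[where g = f]) (auto simp: perm_restrict_simps)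
  qed (simp add: perm_restrict_simps)
  have eq: "orbit f y = orbit ?p y" if "y \<in> V" for y
    using that assms(2)
    by (intro orbit_cong0[of _ V]) (auto simp: bij_betw_def perm_restrict_simps)
  have perm: "permutation ?p" using p assms(1) permutation_permutes by blast
  show "x \<in> orbit f x" using perm assms(3) by (simp add: eq permutation_self_in_orbit)
  show sub: "orbit f x \<subseteq> V" using p assms(3) by (simp add: eq permutes_orbit_subset)
  show "orbit f y = orbit f x" if "y \<in> orbit f x" for y
    using that sub assms(3) orbit_cyclic_eq3[OF cyclic_on_orbit'[OF perm]] by (metis eq subsetD)
qed

lemma invariant_subsets_eq:
  assumes "finite V" "bij_betw f V V"
  shows "{S. S \<subseteq> V \<and> f ` S = S} = Union ` Pow (orbit f ` V)"
proof (intro equalityI subsetI)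
  note orb = orbits_bij_betw[OF assms]
  fix S assume "S \<in> {S. S \<subseteq> V \<and> f ` S = S}"
  then have S: "S \<subseteq> V" "f ` S = S" by auto
  have sub: "orbit f x \<subseteq> S" if "x \<in> S" for x
  proof
    fix y assume "y \<in> orbit f x"
    then show "y \<in> S" by induction (use S that in auto)
  qed
  have "S = \<Union>(orbit f ` S)"
  proof
    show "S \<subseteq> \<Union>(orbit f ` S)" using orb(1) S by blast
    show "\<Union>(orbit f ` S) \<subseteq> S" using sub by blast
  qed
  then show "S \<in> Union ` Pow (orbit f ` V)" using S by blast
next
  note orb = orbits_bij_betw[OF assms]
  fix S assume "S \<in> Union ` Pow (orbit f ` V)"
  then obtain T where T: "T \<subseteq> orbit f ` V" "S = \<Union>T" by blast
  have sub: "S \<subseteq> V" using T orb(2) by blast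
  \<comment> \<open>One inclusion suffices, because \<open>f\<close> is injective on the finite set
    \<open>S\<close>.\<close>
  moreover have "f ` S \<subseteq> S" using T by (auto intro: orbit.step)
  then have "f ` S = S"
    using sub assms by (meson bij_betw_def endo_inj_surj finite_subset inj_on_subset)
  ultimately show "S \<in> {S. S \<subseteq> V \<and> f ` S = S}" by blast
qed

lemma coeff_u_monomial: "coeff_u p q (u1 ^ a * u2 ^ b) = (if a = p \<and> b = q then 1 else 0)"
proof -
  have "u1 ^ a = [:monom 1 a:]" for a
    by (induction a) (simp_all add: u1_def monom_Suc monom_0 one_pCons)
  moreover have "u2 ^ b = monom 1 b" for b
    by (induction b) (simp_all add: u2_def monom_Suc monom_0)
  ultimately show ?thesis by (simp add: coeff_u_def)
qed

lemma coeff_u_sum: "coeff_u p q (sum f A) = (\<Sum>x\<in>A. coeff_u p q (f x))"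
  by (simp add: coeff_u_def coeff_sum)

lemma coeff_u_const_mult: "coeff_u p q ([:[:c:]:] * F) = c * coeff_u p q F"
  by (simp add: coeff_u_def)

text \<open>Expanding the product over the cycles of \<open>f\<close> means choosing
  \<open>u1\<close> or \<open>u2\<close> for each cycle. The set \<open>T\<close> of cycles that
  receive \<open>u1\<close> corresponds to the invariant subset made of their points, and the
  exponent of \<open>u1\<close> is the size of that subset.\<close>

lemma coeff_u_cycle_prod:
  assumes "finite V" "bij_betw f V V" "k \<le> card V"
  shows "coeff_u k (card V - k) (\<Prod>i\<in>{1..card V}. (u1 ^ i + u2 ^ i) ^ cycle_count f V i)
    = of_nat (card {S. S \<subseteq> V \<and> card S = k \<and> f ` S = S})"
proof -
  note orb = orbits_bij_betw[OF assms(1,2)]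
  define \<C> where "\<C> = orbit f ` V"
  have fin: "finite \<C>" using assms by (simp add: \<C>_def)
  have finC: "finite C" "C \<noteq> {}" "C \<subseteq> V" if "C \<in> \<C>" for C
  proof -
    obtain x where x: "x \<in> V" "C = orbit f x" using \<open>C \<in> \<C>\<close> by (auto simp: \<C>_def)
    then show "C \<subseteq> V" "C \<noteq> {}" using orb(1,2)[of x] by auto
    then show "finite C" using assms(1) finite_subset by blast
  qed
  have disj: "C \<inter> D = {}" if "C \<in> \<C>" "D \<in> \<C>" "C \<noteq> D" for C D
  proof (rule ccontr)
    assume "C \<inter> D \<noteq> {}"
    then obtain z where z: "z \<in> C" "z \<in> D" by blast
    then have "orbit f z = C" "orbit f z = D" using that(1,2) orb(3) by (auto simp: \<C>_def)
    then show False using that(3) by simp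
  qed
  have UC: "\<Union>\<C> = V" using orb(1,2) by (auto simp: \<C>_def)
  have cardU: "card (\<Union>T) = (\<Sum>C\<in>T. card C)" if "T \<subseteq> \<C>" for T
  proof (rule card_Union_disjoint)
    show "pairwise disjnt T" using that disj unfolding pairwise_def disjnt_def by (meson subsetD)
  qed (use that finC in blast)
  have "(\<Prod>i\<in>{1..card V}. (u1 ^ i + u2 ^ i) ^ cycle_count f V i)
      = (\<Prod>i\<in>{1..card V}. \<Prod>C\<in>{C \<in> \<C>. card C = i}. u1 ^ card C + u2 ^ card C)"
    by (simp add: cycle_count_def \<C>_def)
  \<comment> \<open>Cycles are nonempty subsets of \<open>V\<close>, so their lengths lie in
    \<open>{1..card V}\<close> and grouping by length misses none.\<close>
  also have "\<dots> = (\<Prod>C\<in>\<C>. u1 ^ card C + u2 ^ card C)"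
  proof (rule prod.group[OF fin])
    show "card ` \<C> \<subseteq> {1..card V}"
      using finC assms(1) by (auto simp: Suc_le_eq card_gt_0_iff card_mono)
  qed simp
  also have "\<dots> = (\<Sum>T\<in>Pow \<C>. (\<Prod>C\<in>T. u1 ^ card C) * (\<Prod>C\<in>\<C> - T. u2 ^ card C))"
    by (rule prod_add[OF fin])
  also have "\<dots> = (\<Sum>T\<in>Pow \<C>. u1 ^ card (\<Union>T) * u2 ^ (card V - card (\<Union>T)))"
  proof (rule sum.cong[OF refl])
    fix T assume "T \<in> Pow \<C>"
    then have "(\<Sum>C\<in>\<C>. card C) = (\<Sum>C\<in>\<C> - T. card C) + (\<Sum>C\<in>T. card C)"
      using fin by (intro sum.subset_diff) auto
    then have "(\<Sum>C\<in>\<C> - T. card C) = card V - card (\<Union>T)"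
      using cardU[of T] cardU[of \<C>] UC \<open>T \<in> Pow \<C>\<close> by simp
    then show "(\<Prod>C\<in>T. u1 ^ card C) * (\<Prod>C\<in>\<C> - T. u2 ^ card C)
        = u1 ^ card (\<Union>T) * u2 ^ (card V - card (\<Union>T))"
      using cardU[of T] \<open>T \<in> Pow \<C>\<close> by (simp flip: power_sum)
  qed
  finally have "coeff_u k (card V - k) (\<Prod>i\<in>{1..card V}. (u1 ^ i + u2 ^ i) ^ cycle_count f V i)
      = (\<Sum>T\<in>Pow \<C>. if card (\<Union>T) = k then 1 else 0)"
    by (auto simp: coeff_u_sum coeff_u_monomial intro!: sum.cong)
  also have "\<dots> = of_nat (card {T \<in> Pow \<C>. card (\<Union>T) = k})"
    using fin by (simp add: sum.If_cases Int_def)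
  also have "card {T \<in> Pow \<C>. card (\<Union>T) = k} = card (Union ` {T \<in> Pow \<C>. card (\<Union>T) = k})"
  proof (rule card_image[symmetric], rule inj_onI)
    \<comment> \<open>Since cycles are nonempty and pairwise disjoint, a set of cycles can be
      recovered from its union, so distinct choices yield distinct subsets.\<close>
    have eq: "T = {C \<in> \<C>. C \<subseteq> \<Union>T}" if "T \<subseteq> \<C>" for T
    proof (intro equalityI subsetI)
      fix C assume C: "C \<in> {C \<in> \<C>. C \<subseteq> \<Union>T}"
      then obtain x where "x \<in> C" using finC by blast
      then obtain D where "D \<in> T" "x \<in> D" using C by blast
      then show "C \<in> T" using disj[of C D] C that \<open>x \<in> C\<close> by blast
    qed (use that in auto)
    fix S T assume "S \<in> {T \<in> Pow \<C>. card (\<Union>T) = k}" "T \<in> {T \<in> Pow \<C>. card (\<Union>T) = k}"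
      and U: "\<Union>S = \<Union>T"
    then have "S = {C \<in> \<C>. C \<subseteq> \<Union>S}" "T = {C \<in> \<C>. C \<subseteq> \<Union>T}"
      by (intro eq; simp)+
    then show "S = T" unfolding U by simp
  qed
  also have "Union ` {T \<in> Pow \<C>. card (\<Union>T) = k} = {S \<in> Union ` Pow \<C>. card S = k}"
    by blast
  also have "\<dots> = {S. S \<subseteq> V \<and> card S = k \<and> f ` S = S}"
    unfolding \<C>_def invariant_subsets_eq[OF assms(1,2), symmetric] by auto
  finally show ?thesis .
qed

section \<open>Substitution into the cycle index and Polya counting of subsets\<close>

lemma subst_superset:
  assumes "finite K" "Poly_Mapping.keys P \<subseteq> K"
  shows "subst f P = (\<Sum>m\<in>K. [:[:Poly_Mapping.lookup P m:]:] *
       (\<Prod>i\<in>Poly_Mapping.keys m. f i ^ Poly_Mapping.lookup m i))"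
  unfolding subst_def using assms
  by (intro sum.mono_neutral_left) (auto simp: in_keys_iff)

lemma subst_add: "subst f (P + Q) = subst f P + subst f Q"
proof -
  let ?K = "Poly_Mapping.keys P \<union> Poly_Mapping.keys Q"
  have "finite ?K" "Poly_Mapping.keys (P + Q) \<subseteq> ?K"
    using keys_add[of P Q] by auto
  then show ?thesis
    by (simp add: subst_superset[where K = ?K] lookup_add sum.distrib[symmetric]
        smult_add_left[symmetric])
qed

lemma subst_sum: "subst f (sum P A) = (\<Sum>x\<in>A. subst f (P x))"
proof (induction A rule: infinite_finite_induct)
  case (insert x A)
  then show ?case by (simp add: subst_add)
qed (simp_all add: subst_def)

lemma subst_monomial:
  "subst f (Poly_Mapping.single m c)
    = [:[:c:]:] * (\<Prod>i\<in>Poly_Mapping.keys m. f i ^ Poly_Mapping.lookup m i)"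
  by (subst subst_superset[where K = "{m}"]) auto

lemma zvar_power: "zvar i ^ c = Poly_Mapping.single (Poly_Mapping.single i c) 1"
  by (induction c) (simp_all add: zvar_def mult_single flip: single_add)

text \<open>Each group element contributes a single monomial to the cycle index, so this case and
  additivity of \<open>subst\<close> suffice; multiplicativity in general is avoided.\<close>

lemma subst_zvar_prod:
  assumes "finite I"
  shows "subst f (Poly_Mapping.single 0 c * (\<Prod>i\<in>I. zvar i ^ e i))
    = [:[:c:]:] * (\<Prod>i\<in>I. f i ^ e i)"
proof -
  define m where "m = (\<Sum>i\<in>I. Poly_Mapping.single i (e i))"
  have "(\<Prod>i\<in>I. zvar i ^ e i) = Poly_Mapping.single m 1"
    unfolding m_def zvar_power using assms by induction (simp_all add: mult_single)
  moreover have "Poly_Mapping.lookup m i = (if i \<in> I then e i else 0)" for i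
    using assms by (simp add: m_def lookup_sum lookup_single when_def)
  \<comment> \<open>The keys of \<open>m\<close> omit the indices with \<open>e i = 0\<close>, whose
    factors are 1.\<close>
  then have "(\<Prod>i\<in>Poly_Mapping.keys m. f i ^ Poly_Mapping.lookup m i) = (\<Prod>i\<in>I. f i ^ e i)"
    using assms by (intro prod.mono_neutral_cong_left) (auto simp: in_keys_iff split: if_splits)
  ultimately show ?thesis by (simp add: mult_single subst_monomial)
qed

lemma two_colour_cycle_index:
  "two_colour (cycle_index G \<phi> V) = [:[:1 / of_nat (card G):]:] *
    (\<Sum>g\<in>G. \<Prod>i\<in>{1..card V}. (u1 ^ i + u2 ^ i) ^ cycle_count (\<phi> g) V i)"
  unfolding two_colour_def cycle_index_def
  by (simp add: sum_distrib_left subst_sum subst_zvar_prod)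

text \<open>Burnside's lemma on the \<open>k\<close>-subsets of \<open>V\<close>, with fixed points
  read off by \<open>coeff_u_cycle_prod\<close>. Faithfulness concerns the whole type: elements that
  agree on \<open>V\<close> are counted separately both in the average and in the cycle
  index.\<close>

lemma (in faithful_action) polya:
  assumes "finite V" and inv: "\<And>g. g \<in> G \<Longrightarrow> \<phi> g ` V = V" and "k \<le> card V"
  defines "\<Y> \<equiv> {S. S \<subseteq> V \<and> card S = k}"
  shows "coeff_u k (card V - k) (two_colour (cycle_index G \<phi> V))
    = of_nat (card (\<Y> // image_rel G \<phi> \<Y>))"
proof -
  have inj: "inj (\<phi> g)" if "g \<in> G" for g using bij_action[OF that] by (rule bij_is_inj)
  have bij: "bij_betw (\<phi> g) V V" if "g \<in> G" for g
    using inj[OF that] inv[OF that] by (simp add: bij_betw_def inj_on_def)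
  have "\<phi> g ` S \<in> \<Y>" if "g \<in> G" "S \<in> \<Y>" for g S
  proof -
    have "\<phi> g ` S \<subseteq> V" using that inv[OF that(1)] by (auto simp: \<Y>_def)
    then show ?thesis
      using that inj[OF that(1)] by (auto simp: \<Y>_def card_image inj_on_def)
  qed
  moreover have "finite \<Y>" using assms(1) by (simp add: \<Y>_def)
  ultimately have "of_nat (card (\<Y> // image_rel G \<phi> \<Y>))
      = (1 / of_nat (card G) * (\<Sum>g\<in>G. of_nat (card {S \<in> \<Y>. \<phi> g ` S = S})) :: rat)"
    by (intro burnside)
  also have "(\<Sum>g\<in>G. of_nat (card {S \<in> \<Y>. \<phi> g ` S = S}) :: rat)
      = (\<Sum>g\<in>G. coeff_u k (card V - k)
          (\<Prod>i\<in>{1..card V}. (u1 ^ i + u2 ^ i) ^ cycle_count (\<phi> g) V i))"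
    using bij assms(1,3)
    by (intro sum.cong refl) (simp only: coeff_u_cycle_prod, simp add: \<Y>_def conj_ac)
  finally show ?thesis
    by (simp only: two_colour_cycle_index coeff_u_const_mult coeff_u_sum)
qed

section \<open>Signed permutations and the cube\<close>

lemma faithful_action_signed_perms:
  "faithful_action (signed_perms :: ('n::finite) signed_perm set) act"
  by standard (use act_id act_comp act_inverse in \<open>auto intro: inj_on_subset[OF act_faithful]\<close>)

lemma faithful_action_stab: "faithful_action (stab H) act"
  unfolding stab_def by (rule faithful_action.stabilizer[OF faithful_action_signed_perms])

lemma inj_act: "g \<in> signed_perms \<Longrightarrow> inj (act g)"
  using faithful_action.bij_action[OF faithful_action_signed_perms] bij_is_inj by blast

text \<open>Subtracting the value at 0 turns \<open>1 - x\<close> into \<open>- x\<close> on the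
  coordinates with negative sign. Hulls and dimension can then be transported through a linear
  injection and a translation.\<close>

lemma act_affine_form:
  assumes "g \<in> signed_perms"
  obtains c L where "linear L" "inj L" "act g = (+) c \<circ> L"
proof
  let ?c = "act g 0" and ?L = "\<lambda>x. act g x - act g 0"
  show "act g = (+) ?c \<circ> ?L" by auto
  show "inj ?L" using inj_act[OF assms] by (auto simp: inj_def)
  show "linear ?L" by (rule linearI) (auto simp: act_def vec_eq_iff algebra_simps)
qed

lemma act_affine_hull:
  assumes "g \<in> signed_perms"
  shows "act g ` (affine hull S) = affine hull (act g ` S)"
proof -
  obtain c L where L: "linear L" "inj L" "act g = (+) c \<circ> L" by (rule act_affine_form[OF assms])
  show ?thesis
    unfolding L(3) image_comp[symmetric] using L(1)
    by (simp add: affine_hull_translation affine_hull_linear_image linear_conv_bounded_linear)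
qed

lemma act_convex_hull:
  assumes "g \<in> signed_perms"
  shows "act g ` (convex hull S) = convex hull (act g ` S)"
proof -
  obtain c L where L: "linear L" "inj L" "act g = (+) c \<circ> L" by (rule act_affine_form[OF assms])
  show ?thesis
    unfolding L(3) image_comp[symmetric] using L(1)
    by (simp add: convex_hull_translation convex_hull_linear_image)
qed

lemma act_aff_dim:
  assumes "g \<in> signed_perms"
  shows "aff_dim (act g ` S) = aff_dim S"
proof -
  obtain c L where L: "linear L" "inj L" "act g = (+) c \<circ> L" by (rule act_affine_form[OF assms])
  show ?thesis
    unfolding L(3) image_comp[symmetric] using L(1,2) by (simp add: aff_dim_translation_eq)
qed

lemma act_cube_vertices:
  assumes "g \<in> signed_perms"
  shows "act g ` cube_vertices = cube_vertices"
proof -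
  have sub: "act h ` cube_vertices \<subseteq> cube_vertices" for h :: "'a signed_perm"
    by (auto simp: act_def cube_vertices_def) metis+
  obtain u where "act g \<circ> act u = id" using act_inverse[OF assms] by blast
  then have "cube_vertices = act g ` act u ` cube_vertices" by (simp add: image_comp)
  also have "\<dots> \<subseteq> act g ` cube_vertices" using sub by blast
  finally show ?thesis using sub by blast
qed

lemma act_vertices_in:
  assumes "g \<in> signed_perms"
  shows "act g ` vertices_in X = vertices_in (act g ` X)"
  using act_cube_vertices[OF assms] inj_act[OF assms]
  by (simp add: vertices_in_def image_Int)

section \<open>Cube vertices: finiteness, affine dimension and convex hulls\<close>

lemma finite_cube_vertices: "finite (cube_vertices :: (real ^ 'n::finite) set)"
proof (rule finite_subset)
  show "(cube_vertices :: (real ^ 'n) set) \<subseteq> range (\<lambda>s. \<chi> i. if s i then 1 else 0)"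
  proof
    fix x :: "real ^ 'n" assume "x \<in> cube_vertices"
    then have "x = (\<chi> i. if x $ i = 1 then 1 else 0)" by (auto simp: cube_vertices_def vec_eq_iff)
    then show "x \<in> range (\<lambda>s. \<chi> i. if s i then 1 else 0)"
      by (rule image_eqI[where x = "\<lambda>i. x $ i = 1"]) simp
  qed
qed simp

lemma finite_vertices_in: "finite (vertices_in (X :: (real ^ 'n::finite) set))"
  by (simp add: vertices_in_def finite_cube_vertices)

text \<open>A coordinate on which \<open>S\<close> is not constant splits \<open>S\<close> into two parts of smaller dimension.\<close>

lemma card_le_power_aff_dim:
  fixes S :: "(real ^ 'n::finite) set"
  assumes "S \<subseteq> cube_vertices" "aff_dim S \<le> int d"
  shows "card S \<le> 2 ^ d"
  using assms
proof (induction d arbitrary: S)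
  case (0 S)
  then have "aff_dim S = -1 \<or> aff_dim S = 0" using aff_dim_geq[of S] by linarith
  then have "S = {} \<or> (\<exists>a. S = {a})" by (simp add: aff_dim_empty[symmetric] aff_dim_eq_0)
  then show ?case by auto
next
  case (Suc d S)
  show ?case
  proof (cases "\<exists>x\<in>S. \<exists>y\<in>S. x \<noteq> y")
    case True
    then obtain x y i where xy: "x \<in> S" "y \<in> S" "x $ i \<noteq> y $ i" by (auto simp: vec_eq_iff)
    define T where "T c = {z \<in> S. z $ i = c}" for c
    have less: "card (T c) \<le> 2 ^ d" for c
    proof (rule Suc.IH)
      have "affine {z :: real ^ 'n. z $ i = c}"
        using affine_hyperplane[of "axis i 1 :: real ^ 'n" c] by (simp add: inner_axis')
      then have "affine hull (T c) \<subseteq> {z. z $ i = c}"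
        by (intro hull_minimal) (auto simp: T_def)
      moreover have "\<not> S \<subseteq> {z. z $ i = c}" using xy by auto
      then have "\<not> affine hull S \<subseteq> {z. z $ i = c}" using hull_subset[of S affine] by blast
      moreover have "affine hull (T c) \<subseteq> affine hull S" by (rule hull_mono) (auto simp: T_def)
      ultimately have "affine hull (T c) \<subset> affine hull S" by blast
      then have "aff_dim (T c) < aff_dim S" by (rule aff_dim_psubset)
      then show "aff_dim (T c) \<le> int d" using Suc.prems(2) by simp
    qed (use Suc.prems in \<open>auto simp: T_def\<close>)
    have "S = T 0 \<union> T 1" using Suc.prems(1) by (auto simp: T_def cube_vertices_def)
    then have "card S \<le> card (T 0) + card (T 1)" using card_Un_le by metis
    then show ?thesis using less[of 0] less[of 1] by simp
  next
    case False
    then have "S = {} \<or> (\<exists>a. S = {a})" by blast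
    then show ?thesis by auto
  qed
qed

text \<open>A cube vertex outside \<open>S\<close> is cut off by an open half-space that contains
  \<open>S\<close>. The half-space is convex, so it contains the hull as well.\<close>

lemma convex_hull_Int_cube_vertices:
  fixes S :: "(real ^ 'n::finite) set"
  assumes "S \<subseteq> cube_vertices"
  shows "convex hull S \<inter> cube_vertices = S"
proof (intro equalityI subsetI)
  fix v assume v: "v \<in> convex hull S \<inter> cube_vertices"
  \<comment> \<open>On the cube, \<open>a \<bullet> x\<close> is maximal exactly at \<open>v\<close>.\<close>
  define a :: "real ^ 'n" where "a = (\<chi> i. 2 * v $ i - 1)"
  have v01: "v $ i = 0 \<or> v $ i = 1" for i using v by (auto simp: cube_vertices_def)
  show "v \<in> S"
  proof (rule ccontr)
    assume "v \<notin> S"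
    have "S \<subseteq> {x. a \<bullet> x < a \<bullet> v}"
    proof
      fix x assume "x \<in> S"
      then have x01: "x $ i = 0 \<or> x $ i = 1" for i using assms by (auto simp: cube_vertices_def)
      have le: "a $ i * x $ i \<le> a $ i * v $ i" for i
        using x01[of i] v01[of i] by (auto simp: a_def)
      obtain j where "x $ j \<noteq> v $ j" using \<open>x \<in> S\<close> \<open>v \<notin> S\<close> by (metis vec_eq_iff)
      then have "a $ j * x $ j < a $ j * v $ j"
        using x01[of j] v01[of j] by (auto simp: a_def)
      with le have "(\<Sum>i\<in>UNIV. a $ i * x $ i) < (\<Sum>i\<in>UNIV. a $ i * v $ i)"
        by (intro sum_strict_mono_ex1) auto
      then show "x \<in> {x. a \<bullet> x < a \<bullet> v}" by (simp add: inner_vec_def)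
    qed
    then have "convex hull S \<subseteq> {x. a \<bullet> x < a \<bullet> v}"
      by (rule hull_minimal) (rule convex_halfspace_lt)
    then show False using v by blast
  qed
qed (use assms hull_subset[of S convex] in auto)

section \<open>Intersections of \<open>H\<close> with its images\<close>

lemma finite_intersections: "finite (intersections H k)"
  by (rule finite_subset[of _ "(\<lambda>w. H \<inter> act w ` H) ` UNIV"]) (auto simp: intersections_def)

text \<open>With n = \<open>CARD('n)\<close>, the flat \<open>X\<close> is a proper subflat of
  \<open>H\<close> and has dimension at most n - 2, while more than 2^(n-3) cube vertices force
  \<open>S\<close> to have dimension at least n - 2. So the hull of \<open>S\<close> fills
  \<open>X\<close>.\<close>

lemma affine_hull_vertices_of_intersection:
  fixes H :: "(real ^ 'n::finite) set"
  assumes "CARD('n) \<ge> 3" "2 ^ (CARD('n) - 3) < k" "hyperplane H"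
    and X: "X \<in> intersections H k" and S: "S \<subseteq> vertices_in X" "card S = k"
  shows "affine hull S = X"
proof -
  obtain w where w: "w \<in> signed_perms" "act w ` H \<noteq> H" "X = H \<inter> act w ` H"
    using X by (auto simp: intersections_def)
  have affH: "affine H" and dimH: "aff_dim H = int CARD('n) - 1"
    using assms(3) by (auto simp: hyperplane_def affine_hyperplane)
  have affw: "affine (act w ` H)" using act_affine_hull[OF w(1), of H] affH
    by (metis affine_hull_eq)
  then have affX: "affine X" using affH w(3) by (simp add: affine_Int)
  have "X \<noteq> H"
  \<comment> \<open>If \<open>X = H\<close>, then \<open>H\<close> lies in its image under
    \<open>w\<close>. Both are flats of the same dimension, hence equal, against the choice of
    \<open>w\<close>.\<close>
  proof
    assume "X = H"
    then have "H \<subseteq> act w ` H" using w(3) by blast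
    then have "H = act w ` H"
      using affine_dim_equal[OF affH affw] dimH act_aff_dim[OF w(1), of H] assms(1)
      by (metis aff_dim_empty_eq aff_dim_empty image_is_empty)
    then show False using w(2) by simp
  qed
  then have "aff_dim X < aff_dim H"
    using aff_dim_psubset[of X H] affX affH w(3) by (metis affine_hull_eq inf_le1 psubsetI)
  moreover have "\<not> aff_dim S \<le> int (CARD('n) - 3)"
    using card_le_power_aff_dim[of S "CARD('n) - 3"] S assms(2)
    by (auto simp: vertices_in_def)
  \<comment> \<open>\<open>CARD('n) - 3\<close> is a natural subtraction, exact because
    \<open>CARD('n)\<close> is at least 3.\<close>
  ultimately have "aff_dim X \<le> aff_dim S" using dimH assms(1) by linarith
  moreover have "affine hull S \<subseteq> X"
    using S(1) affX by (intro hull_minimal) (auto simp: vertices_in_def)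
  ultimately show ?thesis
    using aff_dim_psubset[of S X] affX by (metis affine_hull_eq not_less psubsetI)
qed

section \<open>Partial classes\<close>

text \<open>Taking convex hulls is injective on vertex sets and commutes with the action, so it
  matches orbit classes of vertex sets with classes of polytopes. Positivity of \<open>k\<close>
  keeps the empty set out, as polytopes are nonempty.\<close>

lemma card_partial_classes:
  fixes H :: "(real ^ 'n::finite) set"
  assumes "k > 0"
  defines "\<Y> \<equiv> {S. S \<subseteq> vertices_in H \<and> card S = k}"
  assumes "convex H"
  shows "card (partial_classes H k) = card (\<Y> // image_rel signed_perms act \<Y>)"
proof -
  let ?r = "image_rel signed_perms act \<Y>" and ?R = "partial_equiv H"
  let ?c = "\<lambda>S. convex hull S :: (real ^ 'n) set"
  have inj: "inj_on ?c (Pow cube_vertices)"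
    by (rule inj_on_inverseI[where g = "\<lambda>P. P \<inter> cube_vertices"])
      (simp add: convex_hull_Int_cube_vertices)
  have ne: "S \<noteq> {}" if "card S = k" for S :: "(real ^ 'n) set" using that assms(1) by auto
  have \<Y>: "S \<subseteq> cube_vertices" if "S \<in> \<Y>" for S using that by (auto simp: \<Y>_def vertices_in_def)
  have poly: "?c S \<in> polytopes01_in H" if "S \<in> \<Y>" for S
    using that ne[of S] hull_minimal[of S H convex] assms(3) \<Y>[OF that]
    by (auto simp: polytopes01_in_def polytope01_def \<Y>_def vertices_in_def)
  \<comment> \<open>\<open>?R\<close> relates polytopes of all sizes, but the action preserves the
    number of vertices, so the class of a hull with \<open>k\<close> vertices consists of such hulls
    only.\<close>
  have cls: "?R `` {?c S} = ?c ` (?r `` {S})" if S: "S \<in> \<Y>" for S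
  proof (intro equalityI subsetI)
    fix P assume "P \<in> ?R `` {?c S}"
    then obtain g where g: "g \<in> signed_perms" "P \<in> polytopes01_in H" "P = ?c (act g ` S)"
      by (auto simp: partial_equiv_def act_convex_hull)
    have "act g ` S \<subseteq> cube_vertices" using \<Y>[OF S] act_cube_vertices[OF g(1)] by blast
    moreover have "act g ` S \<subseteq> H"
      using g(2) hull_subset[of "act g ` S" convex] unfolding g(3) by (auto simp: polytopes01_in_def)
    moreover have "card (act g ` S) = k"
      using S inj_act[OF g(1)] by (auto simp: \<Y>_def intro: card_image inj_on_subset)
    ultimately have "act g ` S \<in> \<Y>" by (simp add: \<Y>_def vertices_in_def)
    then have "(S, act g ` S) \<in> ?r" using S g(1) by (auto simp: image_rel_def)
    then show "P \<in> ?c ` (?r `` {S})" using g(3) by blast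
  next
    fix P assume "P \<in> ?c ` (?r `` {S})"
    then obtain g where g: "g \<in> signed_perms" "act g ` S \<in> \<Y>" "P = ?c (act g ` S)"
      by (auto simp: image_rel_def)
    then show "P \<in> ?R `` {?c S}"
      using poly[OF S] poly[OF g(2)] by (auto simp: partial_equiv_def act_convex_hull)
  qed
  have "partial_classes H k = (\<lambda>S. ?R `` {?c S}) ` \<Y>"
  proof (intro equalityI subsetI)
    fix C assume "C \<in> partial_classes H k"
    then obtain P where C: "C \<in> polytopes01_in H // ?R" "P \<in> C" "polytope01_card k P"
      by (auto simp: partial_classes_def)
    then obtain S where S: "S \<subseteq> cube_vertices" "card S = k" "P = ?c S"
      by (auto simp: polytope01_card_def)
    have "P \<in> polytopes01_in H"
      using C equiv_partial_equiv in_quotient_imp_subset by blast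
    then have "S \<in> \<Y>"
      using S hull_subset[of S convex] by (auto simp: \<Y>_def vertices_in_def polytopes01_in_def)
    moreover have "C = ?R `` {P}"
      using C equiv_partial_equiv by (metis Image_singleton_iff equiv_class_eq quotientE)
    ultimately show "C \<in> (\<lambda>S. ?R `` {?c S}) ` \<Y>" using S(3) by blast
  next
    fix C assume "C \<in> (\<lambda>S. ?R `` {?c S}) ` \<Y>"
    then obtain S where S: "S \<in> \<Y>" "C = ?R `` {?c S}" by blast
    have "?c S \<in> C"
      using equiv_class_self[OF equiv_partial_equiv poly[OF S(1)]] S(2) by simp
    moreover have "polytope01_card k (?c S)"
      using \<Y>[OF S(1)] ne[of S] S(1) unfolding polytope01_card_def \<Y>_def by blast
    ultimately show "C \<in> partial_classes H k"
      using poly[OF S(1)] S(2) by (auto simp: partial_classes_def quotientI)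
  qed
  also have "\<dots> = (\<lambda>C. ?c ` C) ` (\<Y> // ?r)" by (auto simp: cls quotient_def)
  also have "card \<dots> = card (\<Y> // ?r)"
  proof (rule card_image, rule inj_on_subset)
    show "inj_on (\<lambda>C. ?c ` C) (Pow (Pow cube_vertices))" using inj by (rule inj_on_image_Pow)
    show "\<Y> // ?r \<subseteq> Pow (Pow cube_vertices)"
      using \<Y> by (auto simp: quotient_def image_rel_def)
  qed
  finally show ?thesis .
qed

text \<open>\<open>card_quotient_fibres\<close> is applied to the affine hull, which sends a set in
  \<open>\<B>\<close> to the only member of \<open>\<E>\<close> containing it. Since
  \<open>G\<close> commutes with hulls, a class lies over one orbit of flats and meets the fibre of
  exactly one representative. \<open>G\<close> will be \<open>stab H\<close> for \<open>E1\<close>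
  and the whole group for \<open>E2\<close>.\<close>

lemma card_quotient_representatives:
  fixes \<E> R :: "(real ^ 'n::finite) set set"
  assumes G: "faithful_action G act" "G \<subseteq> signed_perms"
    and R: "representatives G \<E> R" and "finite \<E>"
    and card: "\<And>X. X \<in> \<E> \<Longrightarrow> k \<le> card (vertices_in X)"
    and hull: "\<And>X S. X \<in> \<E> \<Longrightarrow> S \<subseteq> vertices_in X \<Longrightarrow> card S = k \<Longrightarrow> affine hull S = X"
  defines "\<B> \<equiv> {S. card S = k \<and> (\<exists>X\<in>\<E>. S \<subseteq> vertices_in X)}"
  shows "of_nat (card (\<B> // image_rel G act \<B>)) = (\<Sum>X\<in>R. coeff_u k (card (vertices_in X) - k)
    (two_colour (cycle_index {g \<in> G. act g ` X = X} act (vertices_in X))))"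
proof -
  interpret faithful_action G act by fact
  let ?r = "image_rel G act \<B>"
  have "R \<subseteq> \<E>" using R by (simp add: representatives_def)
  then have "finite R" using \<open>finite \<E>\<close> finite_subset by blast
  have "\<B> \<subseteq> Pow cube_vertices" by (auto simp: \<B>_def vertices_in_def)
  then have finB: "finite \<B>" using finite_cube_vertices by (meson finite_Pow_iff finite_subset)
  have uniq: "\<exists>!Y. Y \<in> R \<and> (\<exists>T. (S, T) \<in> ?r \<and> affine hull T = Y)" if S: "S \<in> \<B>" for S
  proof -
    obtain X where X: "X \<in> \<E>" "S \<subseteq> vertices_in X" "card S = k" using S by (auto simp: \<B>_def)
    then have hX: "affine hull S = X" by (rule hull)
    have "(\<exists>T. (S, T) \<in> ?r \<and> affine hull T = Y) \<longleftrightarrow> (\<exists>g\<in>G. act g ` X = Y)" if "Y \<in> R" for Y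
    proof
      assume "\<exists>T. (S, T) \<in> ?r \<and> affine hull T = Y"
      then obtain g where "g \<in> G" "affine hull (act g ` S) = Y" by (auto simp: image_rel_def)
      then show "\<exists>g\<in>G. act g ` X = Y" using G(2) hX act_affine_hull by blast
    next
      assume "\<exists>g\<in>G. act g ` X = Y"
      then obtain g where g: "g \<in> G" "act g ` X = Y" by blast
      then have gs: "g \<in> signed_perms" using G(2) by blast
      have "act g ` S \<subseteq> vertices_in Y" using X(2) g(2) act_vertices_in[OF gs, of X] by blast
      moreover have "card (act g ` S) = k"
        using X(3) inj_act[OF gs] by (auto intro: card_image inj_on_subset)
      ultimately have "act g ` S \<in> \<B>" "affine hull (act g ` S) = Y"
        using that \<open>R \<subseteq> \<E>\<close> hull by (auto simp: \<B>_def)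
      then show "\<exists>T. (S, T) \<in> ?r \<and> affine hull T = Y"
        using S g(1) by (auto simp: image_rel_def)
    qed
    moreover have "\<exists>!Y. Y \<in> R \<and> (\<exists>g\<in>G. act g ` X = Y)"
      using R X(1) by (simp add: representatives_def)
    ultimately show ?thesis by metis
  qed
  have fibre: "of_nat (card ({S \<in> \<B>. affine hull S = X} //
      (?r \<inter> {S \<in> \<B>. affine hull S = X} \<times> {S \<in> \<B>. affine hull S = X})))
    = coeff_u k (card (vertices_in X) - k)
        (two_colour (cycle_index {g \<in> G. act g ` X = X} act (vertices_in X)))"
    (is "of_nat (card (?F // _)) = _") if "X \<in> R" for X
  proof -
    have X: "X \<in> \<E>" using that \<open>R \<subseteq> \<E>\<close> by blast
    interpret stabX: faithful_action "{g \<in> G. act g ` X = X}" act by (rule stabilizer)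
    have F: "?F = {S. S \<subseteq> vertices_in X \<and> card S = k}"
    proof (intro equalityI subsetI)
      fix S assume "S \<in> ?F"
      then show "S \<in> {S. S \<subseteq> vertices_in X \<and> card S = k}" using hull by (auto simp: \<B>_def)
    qed (use X hull in \<open>auto simp: \<B>_def\<close>)
    \<comment> \<open>Both sets span \<open>X\<close>, so an element carrying one to the other
      stabilizes \<open>X\<close>. On the fibre, equivalence under \<open>G\<close> is therefore
      equivalence under the stabilizer.\<close>
    have "act g ` X = X" if "g \<in> G" "S \<in> ?F" "act g ` S \<in> ?F" for g S
      using that G(2) act_affine_hull[of g S] by auto
    then have "image_rel G act ?F = image_rel {g \<in> G. act g ` X = X} act ?F"
      unfolding image_rel_def by blast
    then have "?r \<inter> ?F \<times> ?F = image_rel {g \<in> G. act g ` X = X} act ?F"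
      using image_rel_restrict[of ?F \<B> G act] by auto
    moreover have "act g ` vertices_in X = vertices_in X" if "g \<in> {g \<in> G. act g ` X = X}" for g
      using that G(2) act_vertices_in[of g X] by auto
    ultimately show ?thesis
      using stabX.polya[OF finite_vertices_in _ card[OF X]] F by simp
  qed
  show ?thesis
    by (simp add: card_quotient_fibres[OF finB equiv_image_rel \<open>finite R\<close> uniq] fibre)
qed

theorem theorem8p3:
  fixes H :: "(real ^ 'n::finite) set" and k :: nat
    and E1 E2 :: "(real ^ 'n) set set"
  assumes "CARD('n) \<ge> 3"
    and "2 ^ (CARD('n) - 3) < k" and "k \<le> 2 ^ (CARD('n) - 2)"
    and "spanned_hyperplane H"
    and "k \<le> card (vertices_in H)"
    and "representatives (stab H) (intersections H k) E1"
    and "representatives signed_perms (intersections H k) E2"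
  shows "of_nat (card (partial_classes H k)) =
      coeff_u k (card (vertices_in H) - k) (C_hyp H)
      - (\<Sum>X\<in>E1. coeff_u k (card (vertices_in X) - k) (C_pair H X))
      + (\<Sum>X\<in>E2. coeff_u k (card (vertices_in X) - k) (C_inter X))"
proof -
  interpret F: faithful_action "stab H" act by (rule faithful_action_stab)
  interpret B: faithful_action "signed_perms :: 'n signed_perm set" act
    by (rule faithful_action_signed_perms)
  define \<Y> where "\<Y> = {S. S \<subseteq> vertices_in H \<and> card S = k}"
  \<comment> \<open>Only on \<open>\<B>\<close> can the classes under \<open>stab H\<close> and
    under all signed permutations differ.\<close>
  define \<B> where "\<B> = {S. card S = k \<and> (\<exists>X\<in>intersections H k. S \<subseteq> vertices_in X)}"
  have hyp: "hyperplane H" using assms(4) by (simp add: spanned_hyperplane_def)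
  have "k > 0" using assms(2) by linarith
  have stab: "stab H \<subseteq> signed_perms" by (auto simp: stab_def)
  have \<B>I: "T \<in> \<B>" if "T \<in> \<Y>" "w \<in> signed_perms" "act w ` H \<noteq> H" "T \<subseteq> act w ` H" for T w
  proof -
    have T: "T \<subseteq> vertices_in (H \<inter> act w ` H)" using that by (auto simp: \<Y>_def vertices_in_def)
    moreover from this have "k \<le> card (vertices_in (H \<inter> act w ` H))"
      using that(1) by (auto simp: \<Y>_def intro: card_mono finite_vertices_in)
    ultimately have "H \<inter> act w ` H \<in> intersections H k"
      using that(2,3) unfolding intersections_def by blast
    then show ?thesis using that(1) T by (auto simp: \<B>_def \<Y>_def)
  qed
  have sub: "\<B> \<subseteq> \<Y>" by (auto simp: \<B>_def \<Y>_def intersections_def vertices_in_def)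
  have finY: "finite \<Y>" by (simp add: \<Y>_def finite_vertices_in)
  have satB: "image_rel signed_perms act \<Y> `` \<B> \<subseteq> \<B>"
  proof
    fix T assume "T \<in> image_rel signed_perms act \<Y> `` \<B>"
    then obtain g S where g: "g \<in> signed_perms" "S \<in> \<B>" "T = act g ` S" "T \<in> \<Y>"
      by (auto simp: image_rel_def)
    then obtain X where "X \<in> intersections H k" "S \<subseteq> X"
      by (auto simp: \<B>_def vertices_in_def)
    then obtain w where w: "w \<in> signed_perms" "act w ` H \<noteq> H" "S \<subseteq> H \<inter> act w ` H"
      unfolding intersections_def by blast
    show "T \<in> \<B>"
    \<comment> \<open>A second hyperplane through \<open>T\<close> is needed. If \<open>g\<close>
      fixes \<open>H\<close>, the image under \<open>g\<close> of the one through \<open>S\<close>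
      serves; otherwise the image of \<open>H\<close> under \<open>g\<close> does.\<close>
    proof (cases "act g ` H = H")
      case True
      obtain u where u: "u \<in> signed_perms" "act u = act g \<circ> act w" using act_comp g(1) w(1) by blast
      have uH: "act u ` H = act g ` act w ` H" unfolding u(2) by (rule image_comp[symmetric])
      then have "act u ` H \<noteq> H" using True w(2) inj_act[OF g(1)] by (metis inj_image_eq_iff)
      moreover have "T \<subseteq> act u ` H" using w(3) g(3) uH by blast
      ultimately show ?thesis using \<B>I g(4) u(1) by blast
    next
      case False
      then show ?thesis using \<B>I[OF g(4) g(1)] w(3) g(3) by blast
    qed
  qed
  then have satF: "image_rel (stab H) act \<Y> `` \<B> \<subseteq> \<B>" using stab by (fastforce simp: image_rel_def)
  \<comment> \<open>An element outside \<open>stab H\<close> that keeps a set within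
    \<open>H\<close> would place its image in \<open>\<B>\<close>, so away from \<open>\<B>\<close>
    the two relations coincide.\<close>
  have rest: "image_rel signed_perms act (\<Y> - \<B>) = image_rel (stab H) act (\<Y> - \<B>)"
  proof -
    have "g \<in> stab H" if "g \<in> signed_perms" "S \<in> \<Y>" "act g ` S \<in> \<Y> - \<B>" for g S
    proof (rule ccontr)
      assume "g \<notin> stab H"
      then have "act g ` H \<noteq> H" using that(1) by (simp add: stab_def)
      moreover have "act g ` S \<subseteq> act g ` H" using that(2) by (auto simp: \<Y>_def vertices_in_def)
      ultimately show False using \<B>I[of "act g ` S" g] that by blast
    qed
    then show ?thesis using stab unfolding image_rel_def by blast
  qed
  have reps: "of_nat (card (\<B> // image_rel G act \<B>)) = (\<Sum>X\<in>R. coeff_u k (card (vertices_in X) - k)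
      (two_colour (cycle_index {g \<in> G. act g ` X = X} act (vertices_in X))))"
    if "faithful_action G act" "G \<subseteq> signed_perms" "representatives G (intersections H k) R" for G R
    unfolding \<B>_def
  proof (rule card_quotient_representatives[OF that finite_intersections])
    show "k \<le> card (vertices_in X)" if "X \<in> intersections H k" for X
      using that by (auto simp: intersections_def)
    show "affine hull S = X"
      if "X \<in> intersections H k" "S \<subseteq> vertices_in X" "card S = k" for X S
      using affine_hull_vertices_of_intersection[OF assms(1,2) hyp that] .
  qed
  \<comment> \<open>Both splittings share the classes of \<open>\<Y> - \<B>\<close>, which cancel.
    The balance is stated additively to avoid truncated subtraction of naturals.\<close>
  have "card (\<Y> // image_rel signed_perms act \<Y>) + card (\<B> // image_rel (stab H) act \<B>)
      = card (\<Y> // image_rel (stab H) act \<Y>) + card (\<B> // image_rel signed_perms act \<B>)"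
    using card_quotient_split[OF finY B.equiv_image_rel sub satB]
      card_quotient_split[OF finY F.equiv_image_rel sub satF]
    by (simp add: image_rel_restrict sub rest)
  then have "(of_nat (card (\<Y> // image_rel signed_perms act \<Y>)) :: rat)
      = of_nat (card (\<Y> // image_rel (stab H) act \<Y>)) - of_nat (card (\<B> // image_rel (stab H) act \<B>))
        + of_nat (card (\<B> // image_rel signed_perms act \<B>))"
    by (simp add: algebra_simps flip: of_nat_add)
  moreover have "convex H" using hyp by (auto simp: hyperplane_def convex_hyperplane)
  then have "card (partial_classes H k) = card (\<Y> // image_rel signed_perms act \<Y>)"
    using card_partial_classes[OF \<open>k > 0\<close>] unfolding \<Y>_def by blast
  moreover have "act g ` vertices_in H = vertices_in H" if "g \<in> stab H" for g
    using that act_vertices_in[of g H] by (auto simp: stab_def)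
  then have "of_nat (card (\<Y> // image_rel (stab H) act \<Y>))
      = coeff_u k (card (vertices_in H) - k) (C_hyp H)"
    using F.polya[OF finite_vertices_in _ assms(5)] by (simp add: C_hyp_def \<Y>_def)
  moreover have "of_nat (card (\<B> // image_rel (stab H) act \<B>))
      = (\<Sum>X\<in>E1. coeff_u k (card (vertices_in X) - k) (C_pair H X))"
    using reps[OF faithful_action_stab stab assms(6)] by (simp add: C_pair_def stab2_def)
  moreover have "of_nat (card (\<B> // image_rel signed_perms act \<B>))
      = (\<Sum>X\<in>E2. coeff_u k (card (vertices_in X) - k) (C_inter X))"
    using reps[OF faithful_action_signed_perms order.refl assms(7)]
    by (simp add: C_inter_def stab_def)
  ultimately show ?thesis by simp
qed

end
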